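(* Let $K$ be a field and let $L_{12}$ be the three-dimensional Leibniz algebra over $K$ with basis $\{e_1,e_2,e_3\}$ and nonzero products of basis elements $e_3e_3=e_1$, $e_1e_3=e_2$. Then the $T$-ideal of polynomial identities of $L_{12}$ is generated by: (i) the polynomials $x_1(x_2x_3)$ and $x_1x_2x_3-x_2x_1x_3$, if $|K|\geq 3$; (ii) the polynomials $x_1(x_2x_3)$ and $x_1x_2x_3-x_2x_1x_3$, together with $x_1^{(2)}x_2-x_1x_2^{(2)}$, if $|K|=2$.
   Context: A (right) Leibniz algebra over $K$ is a $K$-algebra satisfying $x(yz)=(xy)z-(xz)y$. Identities live in the free Leibniz algebra $\mathcal L\langle X\rangle$ over $K$ on $X=\{x_1,x_2,\dots\}$; the $T$-ideal of polynomial identities of $L$ is the set of polynomials vanishing under all substitutions of elements of $L$. A $T$-ideal is an ideal invariant under all endomorphisms of $\mathcal L\langle X\rangle$, and it is generated by $S$ if it is the smallest $T$-ideal containing $S$. Products without brackets are left-normed, and $x^{(m)}$ means $m$ consecutive occurrences of $x$ in a left-normed product; thus $x_1^{(2)}x_2=(x_1x_1)x_2$ and $x_1x_2^{(2)}=(x_1x_2)x_2$. Products of basis elements not listed are zero. *)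

theory Defs
  imports "HOL-Analysis.Analysis"
begin

section \<open>Leibniz algebras\<close>

locale K_algebra = vector_space scale
  for scale :: "'k::field \<Rightarrow> 'a::ab_group_add \<Rightarrow> 'a" +
  fixes mult :: "'a \<Rightarrow> 'a \<Rightarrow> 'a"
  assumes mult_add_left: "mult (x + y) z = mult x z + mult y z"
    and mult_add_right: "mult x (y + z) = mult x y + mult x z"
    and mult_scale_left: "mult (scale c x) y = scale c (mult x y)"
    and mult_scale_right: "mult x (scale c y) = scale c (mult x y)"

locale leibniz_algebra = K_algebra scale mult
  for scale :: "'k::field \<Rightarrow> 'a::ab_group_add \<Rightarrow> 'a" and mult :: "'a \<Rightarrow> 'a \<Rightarrow> 'a" +
  assumes right_leibniz: "mult x (mult y z) = mult (mult x y) z - mult (mult x z) y"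

definition algebra_hom ::
  "('k::field \<Rightarrow> 'a::ab_group_add \<Rightarrow> 'a) \<Rightarrow> ('a \<Rightarrow> 'a \<Rightarrow> 'a) \<Rightarrow>
   ('k \<Rightarrow> 'b::ab_group_add \<Rightarrow> 'b) \<Rightarrow> ('b \<Rightarrow> 'b \<Rightarrow> 'b) \<Rightarrow> ('a \<Rightarrow> 'b) \<Rightarrow> bool" where
  "algebra_hom s1 m1 s2 m2 f \<longleftrightarrow>
     Vector_Spaces.linear s1 s2 f \<and> (\<forall>x y. f (m1 x y) = m2 (f x) (f y))"

definition algebra_ideal ::
  "('k::field \<Rightarrow> 'a::ab_group_add \<Rightarrow> 'a) \<Rightarrow> ('a \<Rightarrow> 'a \<Rightarrow> 'a) \<Rightarrow> 'a set \<Rightarrow> bool" where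
  "algebra_ideal s m I \<longleftrightarrow>
     module.subspace s I \<and> (\<forall>x\<in>I. \<forall>y. m x y \<in> I \<and> m y x \<in> I)"

section \<open>The free Leibniz algebra on countably many generators\<close>

text \<open>
  The free Leibniz algebra is the algebra of formal expressions in the generators modulo the
  least congruence that makes it a Leibniz algebra.  The generator \<open>Gen n\<close> stands
  for $x_{n+1}$.  Negation is multiplication by $-1$.
\<close>

datatype 'k lterm =
    Gen nat
  | Zero
  | Add "'k lterm" "'k lterm"
  | Scale 'k "'k lterm"
  | Mult "'k lterm" "'k lterm"

inductive leib_eq :: "'k::field lterm \<Rightarrow> 'k lterm \<Rightarrow> bool" where
  refl: "leib_eq s s"
| sym: "leib_eq s t \<Longrightarrow> leib_eq t s"
| trans: "leib_eq s t \<Longrightarrow> leib_eq t u \<Longrightarrow> leib_eq s u"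
| cong_add: "leib_eq s s' \<Longrightarrow> leib_eq t t' \<Longrightarrow> leib_eq (Add s t) (Add s' t')"
| cong_scale: "leib_eq s s' \<Longrightarrow> leib_eq (Scale c s) (Scale c s')"
| cong_mult: "leib_eq s s' \<Longrightarrow> leib_eq t t' \<Longrightarrow> leib_eq (Mult s t) (Mult s' t')"
| add_assoc: "leib_eq (Add (Add s t) u) (Add s (Add t u))"
| add_commute: "leib_eq (Add s t) (Add t s)"
| add_zero: "leib_eq (Add Zero s) s"
| add_neg: "leib_eq (Add (Scale (- 1) s) s) Zero"
| scale_add_right: "leib_eq (Scale c (Add s t)) (Add (Scale c s) (Scale c t))"
| scale_add_left: "leib_eq (Scale (c + d) s) (Add (Scale c s) (Scale d s))"
| scale_scale: "leib_eq (Scale c (Scale d s)) (Scale (c * d) s)"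
| scale_one: "leib_eq (Scale 1 s) s"
| mult_add_left: "leib_eq (Mult (Add s t) u) (Add (Mult s u) (Mult t u))"
| mult_add_right: "leib_eq (Mult s (Add t u)) (Add (Mult s t) (Mult s u))"
| mult_scale_left: "leib_eq (Mult (Scale c s) t) (Scale c (Mult s t))"
| mult_scale_right: "leib_eq (Mult s (Scale c t)) (Scale c (Mult s t))"
| right_leibniz: "leib_eq (Mult s (Mult t u))
    (Add (Mult (Mult s t) u) (Scale (- 1) (Mult (Mult s u) t)))"

quotient_type (overloaded) 'k free_leibniz = "'k::field lterm" / leib_eq
  by (intro equivpI reflpI sympI transpI) (auto intro: leib_eq.refl leib_eq.sym leib_eq.trans)

instantiation free_leibniz :: (field) ab_group_add
begin
lift_definition zero_free_leibniz :: "'a free_leibniz" is Zero .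
lift_definition plus_free_leibniz :: "'a free_leibniz \<Rightarrow> 'a free_leibniz \<Rightarrow> 'a free_leibniz"
  is Add by (rule leib_eq.cong_add)
lift_definition uminus_free_leibniz :: "'a free_leibniz \<Rightarrow> 'a free_leibniz"
  is "Scale (- 1)" by (rule leib_eq.cong_scale)
definition minus_free_leibniz :: "'a free_leibniz \<Rightarrow> 'a free_leibniz \<Rightarrow> 'a free_leibniz"
  where "minus_free_leibniz p q = p + - q"
instance
proof
  fix a b c :: "'a free_leibniz"
  show "a + b + c = a + (b + c)" by transfer (rule leib_eq.add_assoc)
  show "a + b = b + a" by transfer (rule leib_eq.add_commute)
  show "0 + a = a" by transfer (rule leib_eq.add_zero)
  show "- a + a = 0" by transfer (rule leib_eq.add_neg)
  show "a - b = a + - b" by (rule minus_free_leibniz_def)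
qed
end

instantiation free_leibniz :: (field) times
begin
lift_definition times_free_leibniz :: "'a free_leibniz \<Rightarrow> 'a free_leibniz \<Rightarrow> 'a free_leibniz"
  is Mult by (rule leib_eq.cong_mult)
instance ..
end

lift_definition fl_scale :: "'k::field \<Rightarrow> 'k free_leibniz \<Rightarrow> 'k free_leibniz"
  is Scale by (rule leib_eq.cong_scale)

lift_definition gen :: "nat \<Rightarrow> 'k::field free_leibniz" is Gen .

lemma leibniz_algebra_free:
  "leibniz_algebra fl_scale ((*) :: 'k::field free_leibniz \<Rightarrow> _)"
proof
  fix a b :: 'k and x y z :: "'k free_leibniz"
  show "fl_scale a (x + y) = fl_scale a x + fl_scale a y"
    by transfer (rule leib_eq.scale_add_right)
  show "fl_scale (a + b) x = fl_scale a x + fl_scale b x"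
    by transfer (rule leib_eq.scale_add_left)
  show "fl_scale a (fl_scale b x) = fl_scale (a * b) x"
    by transfer (rule leib_eq.scale_scale)
  show "fl_scale 1 x = x" by transfer (rule leib_eq.scale_one)
  show "(x + y) * z = x * z + y * z" by transfer (rule leib_eq.mult_add_left)
  show "x * (y + z) = x * y + x * z" by transfer (rule leib_eq.mult_add_right)
  show "fl_scale a x * y = fl_scale a (x * y)" by transfer (rule leib_eq.mult_scale_left)
  show "x * fl_scale a y = fl_scale a (x * y)" by transfer (rule leib_eq.mult_scale_right)
  show "x * (y * z) = x * y * z - x * z * y"
    unfolding minus_free_leibniz_def by transfer (rule leib_eq.right_leibniz)
qed

section \<open>Substitution of algebra elements into polynomials\<close>

primrec eval_lterm ::
  "('k::field \<Rightarrow> 'a::ab_group_add \<Rightarrow> 'a) \<Rightarrow> ('a \<Rightarrow> 'a \<Rightarrow> 'a) \<Rightarrow> (nat \<Rightarrow> 'a) \<Rightarrow> 'k lterm \<Rightarrow> 'a" where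
  "eval_lterm s m v (Gen n) = v n"
| "eval_lterm s m v Zero = 0"
| "eval_lterm s m v (Add t u) = eval_lterm s m v t + eval_lterm s m v u"
| "eval_lterm s m v (Scale c t) = s c (eval_lterm s m v t)"
| "eval_lterm s m v (Mult t u) = m (eval_lterm s m v t) (eval_lterm s m v u)"

text \<open>
  Evaluation uses a representative of the class; the value does not depend on the representative
  when the target is a Leibniz algebra.
\<close>

definition eval ::
  "('k::field \<Rightarrow> 'a::ab_group_add \<Rightarrow> 'a) \<Rightarrow> ('a \<Rightarrow> 'a \<Rightarrow> 'a) \<Rightarrow> (nat \<Rightarrow> 'a) \<Rightarrow> 'k free_leibniz \<Rightarrow> 'a" where
  "eval s m v p = eval_lterm s m v (rep_free_leibniz p)"

context leibniz_algebra
begin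

lemma eval_lterm_cong:
  "leib_eq t u \<Longrightarrow> eval_lterm scale mult v t = eval_lterm scale mult v u"
proof (induction rule: leib_eq.induct)
  case (add_neg s)
  then show ?case by (simp add: scale_minus_left)
next
  case eq: (right_leibniz s t u)
  then show ?case
    by (simp add: right_leibniz[of "eval_lterm scale mult v s"] scale_minus_left)
qed (simp_all add: scale_right_distrib scale_left_distrib mult_add_left mult_add_right
    mult_scale_left mult_scale_right add.assoc add.commute)

lemma eval_abs: "eval scale mult v (abs_free_leibniz t) = eval_lterm scale mult v t"
  unfolding eval_def
  by (rule eval_lterm_cong)
    (simp add: Quotient3_abs_rep[OF Quotient3_free_leibniz] flip: free_leibniz.abs_eq_iff)

lemma eval_simps:
  "eval scale mult v (gen n) = v n"
  "eval scale mult v 0 = 0"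
  "eval scale mult v (p + q) = eval scale mult v p + eval scale mult v q"
  "eval scale mult v (fl_scale c p) = scale c (eval scale mult v p)"
  "eval scale mult v (p * q) = mult (eval scale mult v p) (eval scale mult v q)"
proof -
  show "eval scale mult v (gen n) = v n" by (simp add: gen.abs_eq eval_abs)
  show "eval scale mult v 0 = 0" by (simp add: zero_free_leibniz.abs_eq eval_abs)
  show "eval scale mult v (p + q) = eval scale mult v p + eval scale mult v q"
    by (induction p; induction q) (simp add: plus_free_leibniz.abs_eq eval_abs)
  show "eval scale mult v (fl_scale c p) = scale c (eval scale mult v p)"
    by (induction p) (simp add: fl_scale.abs_eq eval_abs)
  show "eval scale mult v (p * q) = mult (eval scale mult v p) (eval scale mult v q)"
    by (induction p; induction q) (simp add: times_free_leibniz.abs_eq eval_abs)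
qed

lemma algebra_hom_eval: "algebra_hom fl_scale (*) scale mult (eval scale mult v)"
proof -
  interpret F: leibniz_algebra fl_scale "(*) :: 'k free_leibniz \<Rightarrow> _"
    by (rule leibniz_algebra_free)
  show ?thesis
    unfolding algebra_hom_def
    by (intro conjI allI Vector_Spaces.linear.intro module_hom.intro module_hom_axioms.intro
        F.vector_space_axioms vector_space_axioms F.module_axioms module_axioms)
      (simp_all add: eval_simps)
qed

text \<open>The universal property of the free Leibniz algebra.\<close>

lemma free_leibniz_universal:
  "\<exists>!\<phi>. algebra_hom fl_scale (*) scale mult \<phi> \<and> (\<forall>n. \<phi> (gen n) = v n)"
proof (intro ex1I[of _ "eval scale mult v"] conjI allI algebra_hom_eval eval_simps)
  fix \<phi> assume h: "algebra_hom fl_scale (*) scale mult \<phi> \<and> (\<forall>n. \<phi> (gen n) = v n)"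
  then interpret P: Vector_Spaces.linear fl_scale scale \<phi>
    by (simp add: algebra_hom_def)
  have "\<phi> (abs_free_leibniz t) = eval_lterm scale mult v t" for t
  proof (induction t)
    case (Gen n) then show ?case using h by (simp flip: gen.abs_eq)
  next
    case Zero then show ?case using P.zero by (simp flip: zero_free_leibniz.abs_eq)
  next
    case (Add t u) then show ?case using P.add by (simp flip: plus_free_leibniz.abs_eq)
  next
    case (Scale c t) then show ?case using P.scale by (simp flip: fl_scale.abs_eq)
  next
    case (Mult t u) then show ?case
      using h by (simp add: algebra_hom_def flip: times_free_leibniz.abs_eq)
  qed
  then have "\<phi> p = eval scale mult v p" for p
    by (induction p) (simp add: eval_abs)
  then show "\<phi> = eval scale mult v" by blast
qed

end

section \<open>Polynomial identities and T-ideals\<close>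

definition polynomial_identities ::
  "('k::field \<Rightarrow> 'a::ab_group_add \<Rightarrow> 'a) \<Rightarrow> ('a \<Rightarrow> 'a \<Rightarrow> 'a) \<Rightarrow> 'k free_leibniz set" where
  "polynomial_identities s m = {f. \<forall>v. eval s m v f = 0}"

definition T_ideal :: "'k::field free_leibniz set \<Rightarrow> bool" where
  "T_ideal I \<longleftrightarrow> algebra_ideal fl_scale (*) I \<and>
     (\<forall>\<phi>. algebra_hom fl_scale (*) fl_scale (*) \<phi> \<longrightarrow> \<phi> ` I \<subseteq> I)"

definition T_ideal_generated_by :: "'k::field free_leibniz set \<Rightarrow> 'k free_leibniz set \<Rightarrow> bool" where
  "T_ideal_generated_by I S \<longleftrightarrow>
     T_ideal I \<and> S \<subseteq> I \<and> (\<forall>J. T_ideal J \<and> S \<subseteq> J \<longrightarrow> I \<subseteq> J)"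

section \<open>The algebra \<open>L\<^sub>1\<^sub>2\<close>\<close>

text \<open>
  The underlying space is $K^3$ with $e_i$ = \<open>axis i 1\<close>.  In the index type \<open>3\<close> the numeral
  \<open>3\<close> denotes the third index (it coincides with \<open>0\<close>).
\<close>

definition L12_table :: "3 \<Rightarrow> 3 \<Rightarrow> 'k::field ^ 3" where
  "L12_table i j =
     (if i = 3 \<and> j = 3 then axis 1 1 else if i = 1 \<and> j = 3 then axis 2 1 else 0)"

definition L12_mult :: "'k::field ^ 3 \<Rightarrow> 'k ^ 3 \<Rightarrow> 'k ^ 3" where
  "L12_mult u w = (\<Sum>i\<in>UNIV. \<Sum>j\<in>UNIV. (u $ i * w $ j) *s L12_table i j)"

lemma L12_mult_nth:
  "L12_mult u w $ 1 = u $ 3 * w $ 3" "L12_mult u w $ 2 = u $ 1 * w $ 3" "L12_mult u w $ 3 = 0"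
  by (simp_all add: L12_mult_def L12_table_def sum_3 axis_def)

lemma L12_mult_basis: "L12_mult (axis i 1) (axis j 1) = L12_table i j"
  using exhaust_3[of i] exhaust_3[of j]
  by (auto simp: vec_eq_iff forall_3 L12_mult_nth L12_table_def axis_def)

lemma leibniz_algebra_L12: "leibniz_algebra (*s) (L12_mult :: 'k::field ^ 3 \<Rightarrow> _)"
  by unfold_locales (simp_all add: vec_eq_iff forall_3 L12_mult_nth algebra_simps)

end

theory Submission
  imports Defs
begin

text \<open>
  Modulo the identities in (i) the third-degree monomials $x_i x_j x_k$ are symmetric in their
  indices, since right Leibniz and $x(yz) = 0$ give $xyz = xzy$, and all monomials of degree four
  vanish, since $(xy)zt = z(xy)t = 0$.  Hence every polynomial is congruent to a combination of
  $x_i$, $x_i x_j$ and $x_i x_j x_k$ with $i \le j \le k$.  Already the $e_2$-coordinate of the value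
  in $L_{12}$ recovers the coefficients: substituting $x_n = p_n e_1 + q_n e_2 + r_n e_3$ gives
  $\sum a_i q_i + \sum b_{ij} p_i r_j + \sum c_{ijk} r_i r_j r_k$.  The cubic form has zero
  coefficients as soon as it vanishes everywhere, except that over the field with two elements
  $r_i^2 r_j$ and $r_i r_j^2$ agree; there the additional identity removes the monomials
  $x_i x_j x_j$ with $i < j$.
\<close>

section \<open>Evaluation, homomorphisms and T-ideals\<close>

interpretation fl: leibniz_algebra fl_scale "(*) :: 'k::field free_leibniz \<Rightarrow> _"
  by (rule leibniz_algebra_free)

interpretation L12: leibniz_algebra "(*s)" "L12_mult :: 'k::field ^ 3 \<Rightarrow> _"
  by (rule leibniz_algebra_L12)

lemma algebra_hom_compose:
  assumes "algebra_hom s1 m1 s2 m2 f" "algebra_hom s2 m2 s3 m3 g"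
  shows "algebra_hom s1 m1 s3 m3 (g \<circ> f)"
  using assms Vector_Spaces.linear_compose[of s1 s2 f s3 g] by (simp add: algebra_hom_def)

context leibniz_algebra
begin

lemma eval_diff: "eval scale mult v (p - q) = eval scale mult v p - eval scale mult v q"
proof -
  have "eval scale mult v p = eval scale mult v (p - q) + eval scale mult v q"
    by (simp flip: eval_simps)
  then show ?thesis by simp
qed

lemma eval_sum: "eval scale mult v (sum g A) = (\<Sum>i\<in>A. eval scale mult v (g i))"
  by (induction A rule: infinite_finite_induct) (simp_all add: eval_simps)

text \<open>Both sides are homomorphisms in \<open>p\<close> that agree on the generators, so the
  uniqueness half of the universal property identifies them.\<close>

lemma eval_algebra_hom:
  assumes "algebra_hom fl_scale (*) fl_scale (*) \<phi>"
  shows "eval scale mult v (\<phi> p) = eval scale mult (\<lambda>n. eval scale mult v (\<phi> (gen n))) p"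
proof -
  let ?w = "\<lambda>n. eval scale mult v (\<phi> (gen n))"
  have "algebra_hom fl_scale (*) scale mult (eval scale mult v \<circ> \<phi>)"
    using assms algebra_hom_eval by (rule algebra_hom_compose)
  then have "eval scale mult v \<circ> \<phi> = eval scale mult ?w"
    using free_leibniz_universal[of ?w] algebra_hom_eval[of ?w] eval_simps(1)[of ?w]
    by (metis comp_apply)
  then show ?thesis by (metis comp_apply)
qed

lemma mult_zero: "mult 0 x = 0" "mult x 0 = 0"
  using mult_add_left[of 0 0 x] mult_add_right[of x 0 0] by simp_all

text \<open>By \<open>eval_algebra_hom\<close>, applying an endomorphism only changes the assignment
  at which the polynomial is evaluated.\<close>

lemma T_ideal_polynomial_identities: "T_ideal (polynomial_identities scale mult)"
  unfolding T_ideal_def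
proof (intro conjI allI impI subsetI)
  show "algebra_ideal fl_scale (*) (polynomial_identities scale mult)"
    by (simp add: algebra_ideal_def fl.subspace_def polynomial_identities_def eval_simps mult_zero)
next
  fix \<phi> p
  assume "algebra_hom fl_scale (*) fl_scale (*) \<phi>" "p \<in> \<phi> ` polynomial_identities scale mult"
  then show "p \<in> polynomial_identities scale mult"
    by (clarsimp simp only: polynomial_identities_def mem_Collect_eq image_iff)
      (subst eval_algebra_hom; simp)
qed

end

lemma T_ideal_Int: "T_ideal I \<Longrightarrow> T_ideal J \<Longrightarrow> T_ideal (I \<inter> J)"
  unfolding T_ideal_def algebra_ideal_def by (simp add: fl.subspace_inter image_subset_iff)

text \<open>Evaluation in the free algebra itself is an endomorphism; this yields every substitution
  instance of a polynomial in \<open>J\<close>.\<close>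

lemma T_ideal_eval:
  "T_ideal J \<Longrightarrow> p \<in> J \<Longrightarrow> eval fl_scale (*) y p \<in> J"
  using fl.algebra_hom_eval[of y] unfolding T_ideal_def by blast

section \<open>Coefficients of linear combinations and of cubic forms\<close>

text \<open>Coefficients are attached to indices by choosing \<open>T\<close> with \<open>f\<close>
  injective on it; \<open>f\<close> need not be injective on \<open>A\<close>.\<close>

lemma (in vector_space) span_image_explicit:
  assumes "x \<in> span (f ` A)"
  obtains T c where "finite T" "T \<subseteq> A" "x = (\<Sum>t\<in>T. scale (c t) (f t))"
proof -
  from assms obtain t r where t: "finite t" "t \<subseteq> f ` A" "x = (\<Sum>a\<in>t. scale (r a) a)"
    unfolding span_explicit by blast
  from t(2) obtain T where T: "T \<subseteq> A" "inj_on f T" "t = f ` T"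
    by (auto simp: subset_image_inj)
  show ?thesis
    using t(1,3) T by (intro that[of T "\<lambda>i. r (f i)"]) (auto simp: finite_image_iff sum.reindex)
qed

text \<open>Points supported on one, two and three indices isolate the coefficients in turn. The
  hypothesis \<open>squares\<close> either separates \<open>r_i^2 r_j\<close> from
  \<open>r_i r_j^2\<close> or rules out the latter.\<close>

lemma cubic_form_coeffs_zero:
  fixes c :: "nat \<times> nat \<times> nat \<Rightarrow> 'k::field"
  assumes fin: "finite T"
    and sorted: "\<And>i j k. (i, j, k) \<in> T \<Longrightarrow> i \<le> j \<and> j \<le> k"
    and squares: "(\<exists>t::'k. t \<noteq> 0 \<and> t \<noteq> 1) \<or> (\<forall>i j. i < j \<longrightarrow> (i, j, j) \<notin> T)"
    and zero: "\<And>r. (\<Sum>(i, j, k)\<in>T. c (i, j, k) * (r i * r j * r k)) = 0"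
    and "u \<in> T"
  shows "c u = 0"
proof -
  define d where "d u = (if u \<in> T then c u else 0)" for u
  \<comment> \<open>If \<open>r\<close> kills every term outside \<open>U\<close>, the vanishing of
    the form is a relation among the coefficients in \<open>U\<close> alone.\<close>
  have restrict: "(\<Sum>(i, j, k)\<in>U. d (i, j, k) * (r i * r j * r k)) = 0"
    if "finite U"
      and "\<forall>i j k. (i, j, k) \<in> T - U \<longrightarrow> d (i, j, k) = 0 \<or> r i = 0 \<or> r j = 0 \<or> r k = 0"
    for U and r :: "nat \<Rightarrow> 'k"
  proof -
    have "(\<Sum>(i, j, k)\<in>U. d (i, j, k) * (r i * r j * r k))
        = (\<Sum>(i, j, k)\<in>T. c (i, j, k) * (r i * r j * r k))"
      using fin that by (intro sum.mono_neutral_cong) (auto simp: d_def)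
    then show ?thesis using zero by simp
  qed
  have d3: "d (i, i, i) = 0" for i
    using restrict[of "{(i, i, i)}" "\<lambda>n. if n = i then 1 else 0"] by auto
  have d2: "d (i, i, j) = 0 \<and> d (i, j, j) = 0" if "i < j" for i j
  proof -
    have *: "d (i, i, j) * t + d (i, j, j) * (t * t) = 0" for t
    proof -
      \<comment> \<open>Besides the two wanted terms only the cubes of the variables
        \<open>i\<close> and \<open>j\<close> survive here, and \<open>d3\<close> removes
        those.\<close>
      let ?r = "\<lambda>n. if n = i then 1 else if n = j then t else 0"
      have "\<forall>i' j' k'. (i', j', k') \<in> T - {(i, i, j), (i, j, j)} \<longrightarrow>
          d (i', j', k') = 0 \<or> ?r i' = 0 \<or> ?r j' = 0 \<or> ?r k' = 0"
        using that by (auto simp: d3 dest: sorted)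
      from restrict[OF _ this] show ?thesis using that by simp
    qed
    have sum: "d (i, i, j) + d (i, j, j) = 0" using *[of 1] by simp
    show ?thesis
      using squares
    proof
      assume "\<exists>t::'k. t \<noteq> 0 \<and> t \<noteq> 1"
      then obtain t :: 'k where t: "t \<noteq> 0" "t \<noteq> 1" by blast
      \<comment> \<open>Subtracting \<open>t\<close> times the relation \<open>sum\<close> cancels
        \<open>d (i, i, j)\<close>.\<close>
      have "d (i, j, j) * (t * (t - 1)) = 0"
        using *[of t] sum by algebra
      then show ?thesis using t sum by simp
    next
      assume "\<forall>i j. i < j \<longrightarrow> (i, j, j) \<notin> T"
      then show ?thesis using that sum by (simp add: d_def)
    qed
  qed
  obtain i j k where u: "u = (i, j, k)" by (cases u)
  with \<open>u \<in> T\<close> sorted have le: "i \<le> j" "j \<le> k" by auto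
  have "d (i, j, k) = 0"
  proof (cases "i = j \<or> j = k")
    case True
    then show ?thesis using d2 d3 le by (metis le_neq_implies_less)
  next
    case False
    then have lt: "i < j" "j < k" using le by auto
    \<comment> \<open>\<open>(i, j, k)\<close> is the only strictly increasing triple within this
      support; triples with a repetition fall to \<open>d2\<close> and \<open>d3\<close>.\<close>
    let ?r = "\<lambda>n. if n \<in> {i, j, k} then 1 else 0 :: 'k"
    have "\<forall>i' j' k'. (i', j', k') \<in> T - {(i, j, k)} \<longrightarrow>
        d (i', j', k') = 0 \<or> ?r i' = 0 \<or> ?r j' = 0 \<or> ?r k' = 0"
    proof (intro allI impI)
      fix i' j' k' assume "(i', j', k') \<in> T - {(i, j, k)}"
      then have a: "(i', j', k') \<in> T" "(i', j', k') \<noteq> (i, j, k)" by auto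
      show "d (i', j', k') = 0 \<or> ?r i' = 0 \<or> ?r j' = 0 \<or> ?r k' = 0"
      proof (cases "i' = j' \<or> j' = k'")
        case True
        then show ?thesis using d2 d3 sorted[OF a(1)] by (metis le_neq_implies_less)
      next
        case False
        then have "i' < j'" "j' < k'" using sorted[OF a(1)] by auto
        then show ?thesis using lt a(2) by auto
      qed
    qed
    from restrict[OF _ this] show ?thesis by simp
  qed
  then show ?thesis using u \<open>u \<in> T\<close> by (simp add: d_def)
qed

section \<open>Normal monomials and their independence modulo the identities\<close>

text \<open>\<open>P\<close> will stand for the existence of a scalar other than 0 and 1. When it
  fails, \<open>x_i x_j x_j\<close> with \<open>i < j\<close> is dropped in favour of
  \<open>x_i x_i x_j\<close>, which takes the same values on \<open>L_12\<close>.\<close>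

definition normal_triples :: "bool \<Rightarrow> (nat \<times> nat \<times> nat) set" where
  "normal_triples P = {(i, j, k). i \<le> j \<and> j \<le> k \<and> (P \<or> \<not> (i < j \<and> j = k))}"

definition normal_monomials :: "bool \<Rightarrow> 'k::field free_leibniz set" where
  "normal_monomials P = range gen \<union> (\<lambda>(i, j). gen i * gen j) ` UNIV \<union>
     (\<lambda>(i, j, k). gen i * gen j * gen k) ` normal_triples P"

lemma identity_span_normal_monomials:
  fixes s :: "'k::field free_leibniz"
  assumes span: "s \<in> fl.span (normal_monomials P)"
    and P: "P \<Longrightarrow> \<exists>t::'k. t \<noteq> 0 \<and> t \<noteq> 1"
    and id: "s \<in> polynomial_identities (*s) (L12_mult :: 'k ^ 3 \<Rightarrow> _)"
  shows "s = 0"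
proof -
  from span obtain s1 s2 s3 where s: "s = s1 + s2 + s3" and "s1 \<in> fl.span (range gen)"
      "s2 \<in> fl.span ((\<lambda>(i, j). gen i * gen j) ` UNIV)"
      "s3 \<in> fl.span ((\<lambda>(i, j, k). gen i * gen j * gen k) ` normal_triples P)"
    by (auto simp: normal_monomials_def fl.span_Un)
  then obtain A a B b T c where fin: "finite A" "finite B" "finite T" and T: "T \<subseteq> normal_triples P"
    and s1: "s1 = (\<Sum>i\<in>A. fl_scale (a i) (gen i))"
    and s2: "s2 = (\<Sum>u\<in>B. fl_scale (b u) ((\<lambda>(i, j). gen i * gen j) u))"
    and s3: "s3 = (\<Sum>u\<in>T. fl_scale (c u) ((\<lambda>(i, j, k). gen i * gen j * gen k) u))"
    by (elim fl.span_image_explicit) blast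
  have val: "(\<Sum>i\<in>A. a i * q i) + (\<Sum>(i, j)\<in>B. b (i, j) * (p i * r j))
      + (\<Sum>(i, j, k)\<in>T. c (i, j, k) * (r i * r j * r k)) = 0" for p q r
  proof -
    let ?v = "\<lambda>n. \<chi> m. if m = 1 then p n else if m = 2 then q n else r n"
    have "eval (*s) L12_mult ?v s $ 2 = 0"
      using id by (simp add: polynomial_identities_def)
    then show ?thesis
      by (simp add: s s1 s2 s3 L12.eval_simps L12.eval_sum L12_mult_nth case_prod_unfold)
  qed
  have "a i = 0" if "i \<in> A" for i
    using val[of "\<lambda>n. if n = i then 1 else 0" "\<lambda>_. 0" "\<lambda>_. 0"] fin that
    by (simp add: if_distrib[of "(*) _"] cong: if_cong)
  then have s1_0: "s1 = 0" by (simp add: s1)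
  have cubic: "(\<Sum>(i, j, k)\<in>T. c (i, j, k) * (r i * r j * r k)) = 0" for r
    using val[of "\<lambda>_. 0" "\<lambda>_. 0" r] by simp
  \<comment> \<open>Isolating \<open>b\<close> takes a nonzero \<open>r\<close>, so the cubic part
    has to be removed by \<open>cubic\<close>.\<close>
  have "b (i, j) = 0" if "(i, j) \<in> B" for i j
  proof -
    have "(\<Sum>(i', j')\<in>B. b (i', j') * ((if i' = i then 1 else 0) * (if j' = j then 1 else 0))) = 0"
      using val[of "\<lambda>_. 0" "\<lambda>n. if n = i then 1 else 0" "\<lambda>n. if n = j then 1 else 0"] cubic
      by simp
    also have "(\<Sum>(i', j')\<in>B. b (i', j') * ((if i' = i then 1 else 0) * (if j' = j then 1 else 0)))
        = (\<Sum>u\<in>B. if u = (i, j) then b u else 0)"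
      by (intro sum.cong) (auto split: if_splits)
    finally show ?thesis using fin that by simp
  qed
  then have s2_0: "s2 = 0" by (auto simp: s2 intro!: sum.neutral)
  have "c u = 0" if "u \<in> T" for u
    by (rule cubic_form_coeffs_zero[OF fin(3) _ _ cubic that])
      (use T P in \<open>auto simp: normal_triples_def\<close>)
  then show ?thesis by (simp add: s s1_0 s2_0 s3)
qed

section \<open>Reduction to normal monomials\<close>

text \<open>The span contains the generators and is closed under products, hence is the whole free
  algebra.\<close>

lemma span_normal_monomials:
  fixes J :: "'k::field free_leibniz set"
  assumes J: "T_ideal J"
    and right: "gen 0 * (gen 1 * gen 2) \<in> J"
    and comm: "gen 0 * gen 1 * gen 2 - gen 1 * gen 0 * gen 2 \<in> J"
    and squares: "P \<or> gen 0 * gen 0 * gen 1 - gen 0 * gen 1 * gen 1 \<in> J"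
  shows "p \<in> fl.span (J \<union> normal_monomials P)"
proof -
  define V where "V = fl.span (J \<union> normal_monomials P)"
  have sub: "fl.subspace V" by (simp add: V_def)
  have JV: "J \<subseteq> V" and BV: "normal_monomials P \<subseteq> V"
    by (auto simp: V_def intro: fl.span_base)
  have ideal: "x * y \<in> J" "y * x \<in> J" if "x \<in> J" for x y
    using J that by (auto simp: T_ideal_def algebra_ideal_def)
  have J_sub: "fl.subspace J" using J by (simp add: T_ideal_def algebra_ideal_def)
  have right': "x * (y * z) \<in> J" for x y z
    using T_ideal_eval[OF J right, of "\<lambda>n. if n = 0 then x else if n = 1 then y else z"]
    by (simp add: fl.eval_simps)
  have comm': "x * y * z - y * x * z \<in> J" for x y z
    using T_ideal_eval[OF J comm, of "\<lambda>n. if n = 0 then x else if n = 1 then y else z"]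
    by (simp add: fl.eval_simps fl.eval_diff)
  have nil: "x * y * z * t \<in> J" for x y z t
    using fl.subspace_add[OF J_sub comm'[of "x * y" z t] ideal(1)[OF right'[of z x y], of t]] by simp
  have V_cong: "x \<in> V" if "x - y \<in> J" "y \<in> V" for x y
    using fl.subspace_add[OF sub, of "x - y" y] that JV by auto
  define M where "M i j k = (gen i * gen j * gen k :: 'k free_leibniz)" for i j k
  have swap12: "M j i k \<in> V \<Longrightarrow> M i j k \<in> V" for i j k
    unfolding M_def by (rule V_cong[OF comm'])
  have swap23: "M i k j \<in> V \<Longrightarrow> M i j k \<in> V" for i j k
    unfolding M_def by (rule V_cong[OF right'[of "gen i" "gen j" "gen k", unfolded fl.right_leibniz]])
  have normal: "M i j k \<in> V" if "(i, j, k) \<in> normal_triples P" for i j k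
    using that BV by (force simp: M_def normal_monomials_def)
  have sorted: "M i j k \<in> V" if "i \<le> j" "j \<le> k" for i j k
  proof (cases "P \<or> \<not> (i < j \<and> j = k)")
    case True
    with that show ?thesis by (intro normal) (auto simp: normal_triples_def)
  next
    case False
    \<comment> \<open>Here \<open>P\<close> fails, and modulo \<open>J\<close> the monomial is
      congruent to the normal one \<open>M i i j\<close>.\<close>
    then have "gen 0 * gen 0 * gen 1 - gen 0 * gen 1 * gen 1 \<in> J" and jk: "j = k" "i < j"
      using squares by auto
    from T_ideal_eval[OF J this(1), of "\<lambda>n. gen (if n = 0 then i else j)"]
    have "M i i j - M i j j \<in> J"
      by (simp add: M_def fl.eval_simps fl.eval_diff)
    then have "M i j j - M i i j \<in> J"
      using fl.subspace_neg[OF J_sub] by fastforce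
    moreover have "M i i j \<in> V"
      using jk by (intro normal) (auto simp: normal_triples_def)
    ultimately show ?thesis using V_cong jk by blast
  qed
  \<comment> \<open>The two adjacent swaps suffice to sort any three indices.\<close>
  have M: "M i j k \<in> V" for i j k
    using sorted swap12 swap23 by (metis linear)
  have gens: "gen i \<in> V" "gen i * gen j \<in> V" for i j
    using BV by (force simp: normal_monomials_def)+
  have cases_basis: "x \<in> J \<or> (\<exists>i. x = gen i) \<or> (\<exists>i j. x = gen i * gen j) \<or>
      (\<exists>i j k. x = gen i * gen j * gen k)" if "x \<in> J \<union> normal_monomials P" for x
    using that unfolding normal_monomials_def by fast
  have basis_mult: "x * y \<in> V" if xy: "x \<in> J \<union> normal_monomials P" "y \<in> J \<union> normal_monomials P"
    for x y
  proof -
    \<comment> \<open>A right factor that is a product sends the result into \<open>J\<close>.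
      Otherwise right multiplication by a generator raises the degree by one, and degree four lies
      in \<open>J\<close>.\<close>
    consider "x \<in> J \<or> y \<in> J" | z t where "y = z * t" | i k where "x = gen i" "y = gen k"
      | i j k where "x = gen i * gen j" "y = gen k" | i j l k where "x = gen i * gen j * gen l" "y = gen k"
      using cases_basis[OF xy(1)] cases_basis[OF xy(2)] by blast
    then show ?thesis
      using JV ideal right' nil gens M by cases (auto simp: M_def)
  qed
  \<comment> \<open>Bilinearity carries \<open>basis_mult\<close> over to \<open>V\<close>, one
    factor at a time.\<close>
  have left: "x * y \<in> V" if "x \<in> V" "y \<in> J \<union> normal_monomials P" for x y
    using that(1) unfolding V_def
  proof (induction rule: fl.span_induct_alt)
    case base
    show ?case by (simp add: fl.mult_zero fl.span_zero)
  next
    case (step c b z)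
    then show ?case
      using basis_mult[OF _ that(2)]
      by (simp add: V_def fl.mult_add_left fl.mult_scale_left fl.span_add fl.span_scale)
  qed
  have mult: "x * y \<in> V" if "x \<in> V" "y \<in> V" for x y
    using that(2) unfolding V_def
  proof (induction rule: fl.span_induct_alt)
    case base
    show ?case by (simp add: fl.mult_zero fl.span_zero)
  next
    case (step c b z)
    then show ?case
      using left[OF that(1)]
      by (simp add: V_def fl.mult_add_right fl.mult_scale_right fl.span_add fl.span_scale)
  qed
  have "abs_free_leibniz t \<in> V" for t
  proof (induction t)
    case (Gen n) then show ?case using gens by (simp flip: gen.abs_eq)
  next
    case Zero then show ?case
      using fl.subspace_0[OF sub] by (simp flip: zero_free_leibniz.abs_eq)
  next
    case (Add t u) then show ?case
      using fl.subspace_add[OF sub] by (simp flip: plus_free_leibniz.abs_eq)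
  next
    case (Scale c t) then show ?case
      using fl.subspace_scale[OF sub] by (simp flip: fl_scale.abs_eq)
  next
    case (Mult t u) then show ?case
      using mult by (simp flip: times_free_leibniz.abs_eq)
  qed
  then show ?thesis unfolding V_def by (induction p)
qed

section \<open>Generation of the ideal of identities\<close>

text \<open>Modulo \<open>J\<close> an identity is a combination \<open>s\<close> of normal
  monomials; \<open>J_id\<close> makes \<open>s\<close> an identity too, and independence forces
  \<open>s = 0\<close>.\<close>

lemma polynomial_identities_L12_subset:
  fixes J :: "'k::field free_leibniz set"
  assumes J: "T_ideal J"
    and right: "gen 0 * (gen 1 * gen 2) \<in> J"
    and comm: "gen 0 * gen 1 * gen 2 - gen 1 * gen 0 * gen 2 \<in> J"
    and squares: "(\<exists>t::'k. t \<noteq> 0 \<and> t \<noteq> 1) \<or> gen 0 * gen 0 * gen 1 - gen 0 * gen 1 * gen 1 \<in> J"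
    and J_id: "J \<subseteq> polynomial_identities (*s) (L12_mult :: 'k ^ 3 \<Rightarrow> _)"
  shows "polynomial_identities (*s) (L12_mult :: 'k ^ 3 \<Rightarrow> _) \<subseteq> J"
proof
  fix f assume f: "f \<in> polynomial_identities (*s) (L12_mult :: 'k ^ 3 \<Rightarrow> _)"
  define P where "P \<longleftrightarrow> (\<exists>t::'k. t \<noteq> 0 \<and> t \<noteq> 1)"
  have "f \<in> fl.span (J \<union> normal_monomials P)"
    using J right comm squares by (intro span_normal_monomials) (simp_all add: P_def)
  then obtain q s where qs: "f = q + s" "q \<in> fl.span J" "s \<in> fl.span (normal_monomials P)"
    by (auto simp: fl.span_Un)
  have "fl.span J = J"
    using J by (simp add: T_ideal_def algebra_ideal_def)
  with qs(2) have q: "q \<in> J" by blast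
  have "s \<in> polynomial_identities (*s) (L12_mult :: 'k ^ 3 \<Rightarrow> _)"
    using f qs(1) q J_id by (auto simp: polynomial_identities_def L12.eval_simps)
  then have "s = 0"
    using qs(3) by (intro identity_span_normal_monomials) (auto simp: P_def)
  then show "f \<in> J" using qs(1) q by simp
qed

lemma T_ideal_generated_by_L12:
  fixes S :: "'k::field free_leibniz set"
  assumes S: "{gen 0 * (gen 1 * gen 2), gen 0 * gen 1 * gen 2 - gen 1 * gen 0 * gen 2} \<subseteq> S"
    and squares: "(\<exists>t::'k. t \<noteq> 0 \<and> t \<noteq> 1) \<or> gen 0 * gen 0 * gen 1 - gen 0 * gen 1 * gen 1 \<in> S"
    and S_id: "S \<subseteq> polynomial_identities (*s) (L12_mult :: 'k ^ 3 \<Rightarrow> _)"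
  shows "T_ideal_generated_by (polynomial_identities (*s) (L12_mult :: 'k ^ 3 \<Rightarrow> _)) S"
  unfolding T_ideal_generated_by_def
proof (intro conjI allI impI L12.T_ideal_polynomial_identities S_id)
  \<comment> \<open>\<open>J\<close> may be larger than the ideal of identities, so the reduction is carried out modulo the
    intersection.\<close>
  fix J assume J: "T_ideal J \<and> S \<subseteq> J"
  let ?I = "polynomial_identities (*s) (L12_mult :: 'k ^ 3 \<Rightarrow> _)"
  have "?I \<subseteq> J \<inter> ?I"
    using J S squares S_id
    by (intro polynomial_identities_L12_subset T_ideal_Int L12.T_ideal_polynomial_identities) auto
  then show "?I \<subseteq> J" by blast
qed

section \<open>The generating polynomials vanish on \<open>L_12\<close>\<close>

text \<open>Products have zero \<open>e_3\<close> coordinate, and right multiplication depends only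
  on the \<open>e_3\<close> coordinate of the right factor.\<close>

lemma right_nilpotent_identity_L12:
  "x * (y * z) \<in> polynomial_identities (*s) (L12_mult :: 'k::field ^ 3 \<Rightarrow> _)"
  by (simp add: polynomial_identities_def L12.eval_simps vec_eq_iff forall_3 L12_mult_nth)

text \<open>A value of \<open>x y z\<close> is a multiple of \<open>e_2\<close>, with coefficient
  the product of the three \<open>e_3\<close> coordinates, which is symmetric.\<close>

lemma left_commutative_identity_L12:
  "x * y * z - y * x * z \<in> polynomial_identities (*s) (L12_mult :: 'k::field ^ 3 \<Rightarrow> _)"
  by (simp add: polynomial_identities_def L12.eval_simps L12.eval_diff vec_eq_iff forall_3
      L12_mult_nth)

text \<open>Every scalar is 0 or 1, hence idempotent, so the \<open>e_2\<close> coordinates of both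
  monomials reduce to the same product.\<close>

lemma squares_identity_L12:
  assumes "\<nexists>t::'k::field. t \<noteq> 0 \<and> t \<noteq> 1"
  shows "x * x * y - x * y * y \<in> polynomial_identities (*s) (L12_mult :: 'k ^ 3 \<Rightarrow> _)"
proof -
  have "a * a * b = a * b * b" for a b :: 'k
    using assms by (metis mult_cancel_right1 mult_zero_right)
  then show ?thesis
    by (simp add: polynomial_identities_def L12.eval_simps L12.eval_diff vec_eq_iff forall_3
        L12_mult_nth)
qed

text \<open>\<open>CARD('k)\<close> is 0 for an infinite type, so having at least three elements
  takes a separate disjunct for infinite fields.\<close>

lemma field_third_element:
  "(\<exists>t::'k::field. t \<noteq> 0 \<and> t \<noteq> 1) \<longleftrightarrow> infinite (UNIV :: 'k set) \<or> CARD('k) \<ge> 3"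
proof
  assume "\<exists>t::'k. t \<noteq> 0 \<and> t \<noteq> 1"
  then obtain t :: 'k where "t \<noteq> 0" "t \<noteq> 1" by blast
  then have "card {0, 1, t} = 3" by simp
  then show "infinite (UNIV :: 'k set) \<or> CARD('k) \<ge> 3"
    by (metis card_mono subset_UNIV)
next
  assume h: "infinite (UNIV :: 'k set) \<or> CARD('k) \<ge> 3"
  show "\<exists>t::'k. t \<noteq> 0 \<and> t \<noteq> 1"
  proof (rule ccontr)
    assume "\<not> ?thesis"
    then have UNIV: "UNIV = {0, 1 :: 'k}" by auto
    show False using h by (simp add: UNIV)
  qed
qed

theorem theorem3p2:
  fixes x1 x2 x3 :: "'k::field free_leibniz"
  defines "x1 \<equiv> gen 0" and "x2 \<equiv> gen 1" and "x3 \<equiv> gen 2"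
  shows
    "(infinite (UNIV :: 'k set) \<or> CARD('k) \<ge> 3 \<longrightarrow>
        T_ideal_generated_by
          (polynomial_identities (*s) (L12_mult :: 'k ^ 3 \<Rightarrow> _))
          {x1 * (x2 * x3), x1 * x2 * x3 - x2 * x1 * x3}) \<and>
     (CARD('k) = 2 \<longrightarrow>
        T_ideal_generated_by
          (polynomial_identities (*s) (L12_mult :: 'k ^ 3 \<Rightarrow> _))
          {x1 * (x2 * x3), x1 * x2 * x3 - x2 * x1 * x3, x1 * x1 * x2 - x1 * x2 * x2})"
proof (intro conjI impI)
  assume "infinite (UNIV :: 'k set) \<or> CARD('k) \<ge> 3"
  then show "T_ideal_generated_by (polynomial_identities (*s) (L12_mult :: 'k ^ 3 \<Rightarrow> _))
      {x1 * (x2 * x3), x1 * x2 * x3 - x2 * x1 * x3}"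
    unfolding x1_def x2_def x3_def field_third_element[symmetric]
    by (intro T_ideal_generated_by_L12)
      (auto intro: right_nilpotent_identity_L12 left_commutative_identity_L12)
next
  assume card: "CARD('k) = 2"
  \<comment> \<open>Nonzero cardinality entails finiteness, which excludes the infinite disjunct of
    \<open>field_third_element\<close>.\<close>
  then have "finite (UNIV :: 'k set)" by (simp add: card_ge_0_finite)
  with card have "\<nexists>t::'k. t \<noteq> 0 \<and> t \<noteq> 1" by (simp only: field_third_element) simp
  then show "T_ideal_generated_by (polynomial_identities (*s) (L12_mult :: 'k ^ 3 \<Rightarrow> _))
      {x1 * (x2 * x3), x1 * x2 * x3 - x2 * x1 * x3, x1 * x1 * x2 - x1 * x2 * x2}"
    unfolding x1_def x2_def x3_def
    by (intro T_ideal_generated_by_L12)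
      (auto intro: right_nilpotent_identity_L12 left_commutative_identity_L12 squares_identity_L12)
qed

end
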